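(* Assume that the MPSC relaxed constant rank constraint qualification (MPSC-RCRCQ) holds at $\bar{x}\in\mathcal{F}$. Then the MPSC-tailored strong second-order constraint qualification (MPSC-SSOCQ) holds at $\bar{x}$.
   Context: (MPSC) is the problem: minimize $f(x)$ over $x\in\mathbb{R}^n$ subject to $g_i(x)\le 0$ ($i=1,\dots,m$), $h_j(x)=0$ ($j=1,\dots,p$), $G_k(x)H_k(x)=0$ ($k=1,\dots,l$), where $f,g_i,h_j,G_k,H_k:\mathbb{R}^n\to\mathbb{R}$ are twice continuously differentiable. $\mathcal{F}$ denotes its feasible set. For a feasible point $\bar{x}$: $\mathcal{I}_h=\{1,\dots,p\}$, $\mathcal{I}_g=\{i: g_i(\bar{x})=0\}$, $\mathcal{I}_G=\{k: G_k(\bar{x})=0,\,H_k(\bar{x})\neq0\}$, $\mathcal{I}_H=\{k: G_k(\bar{x})\ne0,\,H_k(\bar{x})=0\}$, $\mathcal{I}_{GH}=\{k: G_k(\bar{x})=H_k(\bar{x})=0\}$. MPSC-RCRCQ holds at $\bar{x}$ if there is $\varepsilon>0$ such that for any $\mathcal{I}_1\subseteq\mathcal{I}_g$ and any $\mathcal{I}_3,\mathcal{I}_4\subseteq\mathcal{I}_{GH}$ the family $\{\nabla g_i(x)\}_{i\in\mathcal{I}_1}\cup\{\nabla h_j(x)\}_{j\in\mathcal{I}_h}\cup\{\nabla G_k(x)\}_{k\in\mathcal{I}_3\cup\mathcal{I}_G}\cup\{\nabla H_k(x)\}_{k\in\mathcal{I}_4\cup\mathcal{I}_H}$ has the same rank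 for all $x$ with $\|x-\bar{x}\|<\varepsilon$. Linearization cone: $\mathcal{L}^{MPSC}_{\mathcal{F}}(\bar{x})$ is the set of $d\in\mathbb{R}^n$ with $\nabla g_i(\bar{x})^\top d\le0$ ($i\in\mathcal{I}_g$), $\nabla h_j(\bar{x})^\top d=0$ ($j\in\mathcal{I}_h$), $\nabla G_k(\bar{x})^\top d=0$ ($k\in\mathcal{I}_G$), $\nabla H_k(\bar{x})^\top d=0$ ($k\in\mathcal{I}_H$), $(\nabla G_k(\bar{x})^\top d)(\nabla H_k(\bar{x})^\top d)=0$ ($k\in\mathcal{I}_{GH}$). MPSC-SSOCQ holds at $\bar{x}$ if for every nonzero $d\in\mathcal{L}^{MPSC}_{\mathcal{F}}(\bar{x})$ there exist $\delta>0$, sets $\mathcal{J},\mathcal{K}\subseteq\mathcal{I}_{GH}$ and a twice differentiable arc $\xi:[0,\delta)\to\mathbb{R}^n$ such that $\xi(t)\in\mathcal{F}$ for all $t\in[0,\delta)$; $\xi(0)=\bar{x}$ and $\xi'_+(0)=d$ (right derivative); and for all $t\in[0,\delta)$: $g_i(\xi(t))=0$ for $i\in\mathcal{I}:=\{i\in\mathcal{I}_g:\nabla g_i(\bar{x})^\top d=0\}$, $G_k(\xi(t))=0$ for $k\in\mathcal{I}_G\cup\mathcal{J}$, $H_k(\xi(t))=0$ for $k\in\mathcal{I}_H\cup\mathcal{K}$. *)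

theory Defs
  imports "HOL-Analysis.Analysis"
begin

definition grad :: "('a::real_inner \<Rightarrow> real) \<Rightarrow> 'a \<Rightarrow> 'a" where
  "grad f x = (THE D. GDERIV f x :> D)"

lemma grad_eq:
  assumes "GDERIV f x :> D"
  shows "grad f x = D"
proof -
  have "E = D" if "GDERIV f x :> E" for E
  proof -
    have "(\<lambda>h. inner h E) = (\<lambda>h. inner h D)"
      using that assms unfolding gderiv_def by (rule has_derivative_unique)
    then have "\<forall>h. inner h (E - D) = 0"
      by (metis inner_diff_right right_minus_eq)
    then show ?thesis
      by (metis inner_eq_zero_iff right_minus_eq)
  qed
  with assms show ?thesis
    unfolding grad_def by (rule the_equality[where P = "\<lambda>D. GDERIV f x :> D"])
qed

text \<open>The matrix \<open>Hess x\<close> is the Hessian of \<open>f\<close> at \<open>x\<close>.\<close>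

definition twice_cont_diff :: "(real^'n \<Rightarrow> real) \<Rightarrow> bool" where
  "twice_cont_diff f \<longleftrightarrow>
     (\<forall>x. GDERIV f x :> grad f x) \<and>
     (\<exists>Hess :: real^'n \<Rightarrow> real^'n^'n.
        (\<forall>x. (grad f has_derivative (\<lambda>v. Hess x *v v)) (at x)) \<and>
        continuous_on UNIV Hess)"

text \<open>
  A mathematical program with switching constraints: minimize \<open>obj\<close> subject to
  \<open>ineq i x \<le> 0\<close>, \<open>eqn j x = 0\<close> and \<open>swG k x * swH k x = 0\<close>, where \<open>i\<close>, \<open>j\<close>, \<open>k\<close> range over
  \<open>{1..num_ineq}\<close>, \<open>{1..num_eqn}\<close>, \<open>{1..num_sw}\<close>.  Each of the three numbers may be 0, and
  the constraint functions are irrelevant outside these index ranges.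
\<close>

record ('n::finite) mpsc =
  obj :: "real^'n \<Rightarrow> real"
  num_ineq :: nat
  ineq :: "nat \<Rightarrow> real^'n \<Rightarrow> real"
  num_eqn :: nat
  eqn :: "nat \<Rightarrow> real^'n \<Rightarrow> real"
  num_sw :: nat
  swG :: "nat \<Rightarrow> real^'n \<Rightarrow> real"
  swH :: "nat \<Rightarrow> real^'n \<Rightarrow> real"

definition mpsc_smooth :: "('n::finite) mpsc \<Rightarrow> bool" where
  "mpsc_smooth P \<longleftrightarrow>
     twice_cont_diff (obj P) \<and>
     (\<forall>i\<in>{1..num_ineq P}. twice_cont_diff (ineq P i)) \<and>
     (\<forall>j\<in>{1..num_eqn P}. twice_cont_diff (eqn P j)) \<and>
     (\<forall>k\<in>{1..num_sw P}. twice_cont_diff (swG P k) \<and> twice_cont_diff (swH P k))"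

definition feasible_set :: "('n::finite) mpsc \<Rightarrow> (real^'n) set" where
  "feasible_set P = {x.
     (\<forall>i\<in>{1..num_ineq P}. ineq P i x \<le> 0) \<and>
     (\<forall>j\<in>{1..num_eqn P}. eqn P j x = 0) \<and>
     (\<forall>k\<in>{1..num_sw P}. swG P k x * swH P k x = 0)}"

definition I_h :: "('n::finite) mpsc \<Rightarrow> nat set" where
  "I_h P = {1..num_eqn P}"

definition I_g :: "('n::finite) mpsc \<Rightarrow> real^'n \<Rightarrow> nat set" where
  "I_g P xb = {i\<in>{1..num_ineq P}. ineq P i xb = 0}"

definition I_G :: "('n::finite) mpsc \<Rightarrow> real^'n \<Rightarrow> nat set" where
  "I_G P xb = {k\<in>{1..num_sw P}. swG P k xb = 0 \<and> swH P k xb \<noteq> 0}"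

definition I_H :: "('n::finite) mpsc \<Rightarrow> real^'n \<Rightarrow> nat set" where
  "I_H P xb = {k\<in>{1..num_sw P}. swG P k xb \<noteq> 0 \<and> swH P k xb = 0}"

definition I_GH :: "('n::finite) mpsc \<Rightarrow> real^'n \<Rightarrow> nat set" where
  "I_GH P xb = {k\<in>{1..num_sw P}. swG P k xb = 0 \<and> swH P k xb = 0}"

text \<open>
  The gradients at \<open>x\<close> of selected constraints.  The rank of this family of vectors is the
  dimension of its span, so collecting the family into a set loses nothing.
\<close>

definition grad_family ::
  "('n::finite) mpsc \<Rightarrow> nat set \<Rightarrow> nat set \<Rightarrow> nat set \<Rightarrow> nat set \<Rightarrow> real^'n \<Rightarrow> (real^'n) set" where
  "grad_family P A B C D x =
     (\<lambda>i. grad (ineq P i) x) ` A \<union> (\<lambda>j. grad (eqn P j) x) ` B \<union>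
     (\<lambda>k. grad (swG P k) x) ` C \<union> (\<lambda>k. grad (swH P k) x) ` D"

definition MPSC_RCRCQ :: "('n::finite) mpsc \<Rightarrow> real^'n \<Rightarrow> bool" where
  "MPSC_RCRCQ P xb \<longleftrightarrow>
     (\<exists>\<epsilon>>0. \<forall>I1 I3 I4. I1 \<subseteq> I_g P xb \<longrightarrow> I3 \<subseteq> I_GH P xb \<longrightarrow> I4 \<subseteq> I_GH P xb \<longrightarrow>
        (\<exists>r. \<forall>x. norm (x - xb) < \<epsilon> \<longrightarrow>
           dim (grad_family P I1 (I_h P) (I3 \<union> I_G P xb) (I4 \<union> I_H P xb) x) = r))"

definition lin_cone :: "('n::finite) mpsc \<Rightarrow> real^'n \<Rightarrow> (real^'n) set" where
  "lin_cone P xb = {d.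
     (\<forall>i\<in>I_g P xb. grad (ineq P i) xb \<bullet> d \<le> 0) \<and>
     (\<forall>j\<in>I_h P. grad (eqn P j) xb \<bullet> d = 0) \<and>
     (\<forall>k\<in>I_G P xb. grad (swG P k) xb \<bullet> d = 0) \<and>
     (\<forall>k\<in>I_H P xb. grad (swH P k) xb \<bullet> d = 0) \<and>
     (\<forall>k\<in>I_GH P xb. (grad (swG P k) xb \<bullet> d) * (grad (swH P k) xb \<bullet> d) = 0)}"

text \<open>Derivatives relative to \<open>S\<close>: on \<open>{0..<\<delta>}\<close> they are one-sided at \<open>0\<close>.\<close>

definition twice_diff_arc_on :: "(real \<Rightarrow> real^'n) \<Rightarrow> real set \<Rightarrow> bool" where
  "twice_diff_arc_on \<xi> S \<longleftrightarrow>
     (\<exists>\<xi>' \<xi>''. \<forall>t\<in>S. (\<xi> has_vector_derivative \<xi>' t) (at t within S) \<and>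
                      (\<xi>' has_vector_derivative \<xi>'' t) (at t within S))"

definition MPSC_SSOCQ :: "('n::finite) mpsc \<Rightarrow> real^'n \<Rightarrow> bool" where
  "MPSC_SSOCQ P xb \<longleftrightarrow>
     (\<forall>d\<in>lin_cone P xb. d \<noteq> 0 \<longrightarrow>
        (\<exists>\<delta>>0. \<exists>J K. \<exists>\<xi> :: real \<Rightarrow> real^'n.
           J \<subseteq> I_GH P xb \<and> K \<subseteq> I_GH P xb \<and>
           twice_diff_arc_on \<xi> {0..<\<delta>} \<and>
           (\<forall>t\<in>{0..<\<delta>}. \<xi> t \<in> feasible_set P) \<and>
           \<xi> 0 = xb \<and> (\<xi> has_vector_derivative d) (at_right 0) \<and>
           (\<forall>t\<in>{0..<\<delta>}.
              (\<forall>i\<in>{i\<in>I_g P xb. grad (ineq P i) xb \<bullet> d = 0}. ineq P i (\<xi> t) = 0) \<and>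
              (\<forall>k\<in>I_G P xb \<union> J. swG P k (\<xi> t) = 0) \<and>
              (\<forall>k\<in>I_H P xb \<union> K. swH P k (\<xi> t) = 0))))"

end

theory Submission
  imports Defs
begin

text \<open>
  Fix a direction \<open>d\<close> of the linearization cone and collect in a finite set \<open>S\<close> the
  constraint functions whose gradient at \<open>xb\<close> is orthogonal to \<open>d\<close> and that the arc has to keep
  at zero: all \<open>eqn\<close>, the active \<open>ineq\<close> with \<open>grad \<bullet> d = 0\<close>, each \<open>swG\<close> and \<open>swH\<close> that
  vanishes at \<open>xb\<close> while its partner does not, and of the biactive indices
  those \<open>swG\<close> (index set \<open>J\<close>) and those \<open>swH\<close> (index set \<open>K\<close>) with gradient orthogonal to \<open>d\<close>.  Since the product condition in the cone makes
  \<open>J\<close> and \<open>K\<close> cover the biactive indices, an arc in the common zero set of \<open>S\<close> satisfies all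
  switching constraints, and along it the remaining inequalities are negative for small positive
  time: they are inactive at \<open>xb\<close>, or decrease to first order in direction \<open>d\<close>.

  The gradients of \<open>S\<close> are one of the families whose rank is constant near \<open>xb\<close>.  This reduces the
  theorem to the following statement (\<open>constant_rank_arc\<close>): if the functions of \<open>S\<close>
  vanish at \<open>p\<close> and their gradients have constant rank near \<open>p\<close> and are orthogonal to \<open>d\<close> at \<open>p\<close>, then a twice differentiable arc
  leaves \<open>p\<close> with velocity \<open>d\<close> inside the zero set of \<open>S\<close>.  Instead of the implicit function
  theorem, the proof uses a differential equation.  It constructs a \<open>C\<^sup>1\<close> vector field \<open>F\<close> with
  \<open>F p = d\<close> that is orthogonal to all gradients near \<open>p\<close>; an integral curve \<open>\<xi>\<close> of \<open>F\<close> keeps each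
  function of \<open>S\<close> constant, hence zero, has initial velocity \<open>d\<close>, and is twice differentiable because
  \<open>\<xi>' = F \<circ> \<xi>\<close>.

  The field comes from \<open>orthogonal_C1_field\<close>, applied to gradients that form a basis at \<open>p\<close> of the
  span of all gradients.  These stay independent near \<open>p\<close> (\<open>eventually_independent\<close>), so by
  constancy of the rank they continue to span all gradients, and orthogonality to the basis
  extends to the whole family.
\<close>

section \<open>Continuously differentiable fields\<close>

definition C1_field :: "('a::real_normed_vector \<Rightarrow> 'b::real_normed_vector) \<Rightarrow> bool" where
  "C1_field F \<longleftrightarrow>
     (\<exists>F'. (\<forall>x. (F has_derivative blinfun_apply (F' x)) (at x)) \<and> continuous_on UNIV F')"

lemma C1_field_imp_continuous_on: "C1_field F \<Longrightarrow> continuous_on S F"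
  unfolding C1_field_def
  by (meson continuous_at_imp_continuous_on has_derivative_continuous)

lemma C1_field_const: "C1_field (\<lambda>x. c)"
  unfolding C1_field_def
  by (rule exI[of _ "\<lambda>x. 0"]) (simp add: zero_blinfun.rep_eq)

lemma C1_field_diff:
  assumes "C1_field F" "C1_field G"
  shows "C1_field (\<lambda>x. F x - G x)"
proof -
  obtain F' G' where F': "\<And>x. (F has_derivative blinfun_apply (F' x)) (at x)" "continuous_on UNIV F'"
    and G': "\<And>x. (G has_derivative blinfun_apply (G' x)) (at x)" "continuous_on UNIV G'"
    using assms unfolding C1_field_def by blast
  have "((\<lambda>x. F x - G x) has_derivative blinfun_apply (F' x - G' x)) (at x)" for x
    by (rule has_derivative_eq_rhs, rule has_derivative_diff[OF F'(1) G'(1)]) (simp add: fun_eq_iff blinfun.diff_left)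
  then show ?thesis
    unfolding C1_field_def using continuous_on_diff[OF F'(2) G'(2)]
    by (intro exI[of _ "\<lambda>x. F' x - G' x"]) simp
qed

lemma C1_field_inner:
  assumes "C1_field F" "C1_field G"
  shows "C1_field (\<lambda>x. F x \<bullet> G x)"
proof -
  obtain F' G' where F': "\<And>x. (F has_derivative blinfun_apply (F' x)) (at x)" "continuous_on UNIV F'"
    and G': "\<And>x. (G has_derivative blinfun_apply (G' x)) (at x)" "continuous_on UNIV G'"
    using assms unfolding C1_field_def by blast
  define D where "D x = (blinfun_inner_right (F x) o\<^sub>L G' x) + (blinfun_inner_left (G x) o\<^sub>L F' x)" for x
  have "((\<lambda>x. F x \<bullet> G x) has_derivative blinfun_apply (D x)) (at x)" for x
    by (rule has_derivative_eq_rhs, rule has_derivative_inner[OF F'(1) G'(1)])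
       (simp add: D_def fun_eq_iff blinfun.add_left blinfun_inner_right.rep_eq blinfun_inner_left.rep_eq)
  moreover have "continuous_on UNIV D"
    unfolding D_def
    by (intro continuous_intros F'(2) G'(2) C1_field_imp_continuous_on assms
         bounded_linear.continuous_on[OF bounded_linear_blinfun_inner_right]
         bounded_linear.continuous_on[OF bounded_linear_blinfun_inner_left])
  ultimately show ?thesis
    unfolding C1_field_def by blast
qed

lemma C1_field_scaleR:
  assumes "C1_field f" "C1_field G"
  shows "C1_field (\<lambda>x. f x *\<^sub>R G x)"
proof -
  obtain f' G' where f': "\<And>x. (f has_derivative blinfun_apply (f' x)) (at x)" "continuous_on UNIV f'"
    and G': "\<And>x. (G has_derivative blinfun_apply (G' x)) (at x)" "continuous_on UNIV G'"
    using assms unfolding C1_field_def by blast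
  define D where "D x = f x *\<^sub>R G' x + (blinfun_scaleR_left (G x) o\<^sub>L f' x)" for x
  have "((\<lambda>x. f x *\<^sub>R G x) has_derivative blinfun_apply (D x)) (at x)" for x
    by (rule has_derivative_eq_rhs, rule has_derivative_scaleR[OF f'(1) G'(1)])
       (simp add: D_def fun_eq_iff blinfun.add_left blinfun.scaleR_left)
  moreover have "continuous_on UNIV D"
    unfolding D_def
    by (intro continuous_intros f'(2) G'(2) C1_field_imp_continuous_on assms
         bounded_linear.continuous_on[OF bounded_linear_blinfun_scaleR_left])
  ultimately show ?thesis
    unfolding C1_field_def by blast
qed

lemma C1_field_grad:
  fixes f :: "real^'n \<Rightarrow> real"
  assumes "twice_cont_diff f"
  shows "C1_field (grad f)"
proof -
  obtain Hess :: "real^'n \<Rightarrow> real^'n^'n"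
    where Hess: "\<And>x. (grad f has_derivative (\<lambda>v. Hess x *v v)) (at x)" "continuous_on UNIV Hess"
    using assms unfolding twice_cont_diff_def by blast
  define D where "D x = Blinfun (\<lambda>v. Hess x *v v)" for x
  have D: "blinfun_apply (D x) = (\<lambda>v. Hess x *v v)" for x
    unfolding D_def by (rule bounded_linear_Blinfun_apply) (rule matrix_vector_mul_bounded_linear)
  have "continuous_on UNIV (\<lambda>x. Hess x *v v)" for v
    unfolding matrix_vector_mult_def by (intro continuous_intros Hess(2))
  then have "continuous_on UNIV D"
    by (intro continuous_on_blinfun_componentwise) (simp add: D)
  then show ?thesis
    unfolding C1_field_def using Hess(1) D by metis
qed

lemma C1_field_locally_lipschitz:
  fixes F :: "'a::euclidean_space \<Rightarrow> 'a"
  assumes "C1_field F"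
  obtains r L where "r > 0" "L-lipschitz_on (cball p r) F"
proof -
  obtain F' where F': "\<And>x. (F has_derivative blinfun_apply (F' x)) (at x)" "continuous_on UNIV F'"
    using assms unfolding C1_field_def by blast
  have "local_lipschitz (UNIV :: real set) UNIV (\<lambda>t. F)"
  proof (rule c1_implies_local_lipschitz)
    show "continuous_on (UNIV \<times> UNIV) (\<lambda>z :: real \<times> 'a. F' (snd z))"
      by (rule continuous_on_compose2[OF F'(2)]) (auto intro: continuous_intros)
  qed (use F'(1) in auto)
  from local_lipschitzE[OF this, of 0 p] that show ?thesis
    by (metis Int_UNIV_right UNIV_I centre_in_cball less_imp_le)
qed

section \<open>Fields orthogonal to a given system\<close>

lemma orthogonal_component:
  fixes u :: "'a::euclidean_space"
  assumes "u \<notin> span V"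
  obtains z where "\<And>w. w \<in> V \<Longrightarrow> w \<bullet> z = 0" "u \<bullet> z \<noteq> 0"
proof -
  obtain y z where y: "y \<in> span V" and z: "\<And>w. w \<in> span V \<Longrightarrow> orthogonal z w" and u: "u = y + z"
    using orthogonal_subspace_decomp_exists[of V u] by blast
  have "y \<bullet> z = 0"
    using z[OF y] by (simp add: orthogonal_def inner_commute)
  moreover have "z \<noteq> 0"
    using assms y u by auto
  ultimately have "u \<bullet> z \<noteq> 0"
    by (simp add: u inner_add_left)
  moreover have "w \<bullet> z = 0" if "w \<in> V" for w
    using z[OF span_base[OF that]] by (simp add: orthogonal_def inner_commute)
  ultimately show thesis
    using that by blast
qed

text \<open>
  Independence is required at the single point \<open>p\<close>, yet the field is orthogonal to the system
  everywhere.  To enlarge the system by \<open>v b\<close>, take two fields orthogonal to the smaller system: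
  \<open>F\<close> through \<open>d\<close>, and \<open>E\<close> through a vector that has inner product 1 with \<open>v b p\<close>.  Then
  \<open>(v b \<bullet> E) F - (v b \<bullet> F) E\<close> is orthogonal to \<open>v b\<close> as well.  This is the usual elimination
  step \<open>F - ((v b \<bullet> F) / (v b \<bullet> E)) E\<close> multiplied by its denominator: the result is defined and
  smooth also where the denominator vanishes, and its value at \<open>p\<close> is still \<open>d\<close>.
\<close>

lemma orthogonal_C1_field:
  fixes v :: "'i \<Rightarrow> 'a::euclidean_space \<Rightarrow> 'a"
  assumes "finite B" "\<forall>b\<in>B. C1_field (v b)"
    and "inj_on (\<lambda>b. v b p) B" "independent ((\<lambda>b. v b p) ` B)" "\<forall>b\<in>B. v b p \<bullet> d = 0"
  shows "\<exists>F. C1_field F \<and> F p = d \<and> (\<forall>b\<in>B. \<forall>x. v b x \<bullet> F x = 0)"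
  using assms
proof (induction B arbitrary: d rule: finite_induct)
  case empty
  show ?case
    using C1_field_const[of d] by auto
next
  case (insert b B)
  let ?V = "(\<lambda>b. v b p) ` B"
  have indep: "inj_on (\<lambda>b. v b p) B" "independent ?V"
    using insert.prems(2) independent_mono[OF insert.prems(3), of ?V] by auto
  have notin: "v b p \<notin> span ?V"
    using insert.prems(2,3) insert.hyps(2) by (auto simp: independent_insert split: if_splits)
  obtain z where z: "\<And>w. w \<in> ?V \<Longrightarrow> w \<bullet> z = 0" "v b p \<bullet> z \<noteq> 0"
    using orthogonal_component[OF notin] by blast
  define e where "e = z /\<^sub>R (v b p \<bullet> z)"
  have e: "\<forall>c\<in>B. v c p \<bullet> e = 0" "v b p \<bullet> e = 1"
    using z by (auto simp: e_def)
  obtain E where E: "C1_field E" "E p = e" "\<forall>c\<in>B. \<forall>x. v c x \<bullet> E x = 0"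
    using insert.IH[of e] insert.prems(1) indep e(1) by auto
  obtain F where F: "C1_field F" "F p = d" "\<forall>c\<in>B. \<forall>x. v c x \<bullet> F x = 0"
    using insert.IH[of d] insert.prems indep by auto
  let ?K = "\<lambda>x. (v b x \<bullet> E x) *\<^sub>R F x - (v b x \<bullet> F x) *\<^sub>R E x"
  have "C1_field ?K"
    using insert.prems(1) E(1) F(1)
    by (auto intro!: C1_field_diff C1_field_scaleR C1_field_inner)
  moreover have "?K p = d"
    using E(2) F(2) e(2) insert.prems(4) by simp
  moreover have "\<forall>c\<in>insert b B. \<forall>x. v c x \<bullet> ?K x = 0"
    using E(3) F(3) by (simp add: inner_diff_right)
  ultimately show ?case
    by (intro exI[of _ ?K]) blast
qed

text \<open>
  Each \<open>b\<close> has a field \<open>E b\<close> orthogonal to the other members of the system everywhere, but not to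
  \<open>v b\<close> at \<open>p\<close>.  By continuity it is not orthogonal to \<open>v b\<close> near \<open>p\<close> either, and there it
  certifies that \<open>v b x\<close> lies outside the span of the others.
\<close>

lemma eventually_independent:
  fixes v :: "'i \<Rightarrow> 'a::euclidean_space \<Rightarrow> 'a"
  assumes "finite B" "\<forall>b\<in>B. C1_field (v b)"
    and "inj_on (\<lambda>b. v b p) B" "independent ((\<lambda>b. v b p) ` B)"
  shows "\<forall>\<^sub>F x in nhds p. inj_on (\<lambda>b. v b x) B \<and> independent ((\<lambda>b. v b x) ` B)"
proof -
  have "\<exists>E. C1_field E \<and> v b p \<bullet> E p \<noteq> 0 \<and> (\<forall>c\<in>B-{b}. \<forall>x. v c x \<bullet> E x = 0)" if b: "b \<in> B" for b
  proof -
    let ?V = "(\<lambda>b. v b p) ` (B-{b})"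
    have "?V = (\<lambda>b. v b p) ` B - {v b p}"
      using assms(3) b by (auto simp: inj_on_def)
    then have notin: "v b p \<notin> span ?V"
      using assms(4) b unfolding dependent_def by auto
    obtain z where z: "\<And>w. w \<in> ?V \<Longrightarrow> w \<bullet> z = 0" "v b p \<bullet> z \<noteq> 0"
      using orthogonal_component[OF notin] by blast
    have "\<exists>E. C1_field E \<and> E p = z \<and> (\<forall>c\<in>B-{b}. \<forall>x. v c x \<bullet> E x = 0)"
      using z(1) assms inj_on_subset[OF assms(3), of "B-{b}"]
        independent_mono[OF assms(4) image_mono[of "B-{b}" B]]
      by (intro orthogonal_C1_field) auto
    then show ?thesis
      using z(2) by auto
  qed
  then obtain E where E: "\<And>b. b \<in> B \<Longrightarrow> C1_field (E b)" "\<And>b. b \<in> B \<Longrightarrow> v b p \<bullet> E b p \<noteq> 0"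
    "\<And>b c x. b \<in> B \<Longrightarrow> c \<in> B-{b} \<Longrightarrow> v c x \<bullet> E b x = 0"
    by metis
  have "\<forall>\<^sub>F x in nhds p. v b x \<bullet> E b x \<noteq> 0" if b: "b \<in> B" for b
  proof -
    have "continuous_on UNIV (\<lambda>x. v b x \<bullet> E b x)"
      using assms(2) E(1) b by (intro C1_field_imp_continuous_on C1_field_inner) auto
    then have "isCont (\<lambda>x. v b x \<bullet> E b x) p"
      by (simp add: continuous_on_eq_continuous_at)
    then have "filterlim (\<lambda>x. v b x \<bullet> E b x) (nhds (v b p \<bullet> E b p)) (nhds p)"
      using tendsto_at_iff_tendsto_nhds[of "\<lambda>x. v b x \<bullet> E b x" p] by (simp add: isCont_def)
    then show ?thesis
      using tendsto_imp_eventually_ne E(2)[OF b] by blast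
  qed
  then have "\<forall>\<^sub>F x in nhds p. \<forall>b\<in>B. v b x \<bullet> E b x \<noteq> 0"
    using assms(1) by (simp add: eventually_ball_finite)
  then show ?thesis
  proof eventually_elim
    case (elim x)
    have "inj_on (\<lambda>b. v b x) B"
    proof (rule inj_onI, rule ccontr)
      fix b c assume bc: "b \<in> B" "c \<in> B" "v b x = v c x" "b \<noteq> c"
      then have "v c x \<bullet> E b x = 0"
        by (intro E(3)) auto
      then show False
        using elim bc by metis
    qed
    moreover have "v b x \<notin> span ((\<lambda>b. v b x) ` B - {v b x})" if b: "b \<in> B" for b
    proof
      assume "v b x \<in> span ((\<lambda>b. v b x) ` B - {v b x})"
      moreover have "w \<in> (\<lambda>b. v b x) ` B - {v b x} \<Longrightarrow> orthogonal (E b x) w" for w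
        using E(3)[OF b] by (auto simp: orthogonal_def inner_commute[of "E b x"])
      ultimately have "orthogonal (E b x) (v b x)"
        by (rule orthogonal_to_span)
      then show False
        using elim b by (simp add: orthogonal_def inner_commute)
    qed
    ultimately show ?case
      unfolding dependent_def by blast
  qed
qed

text \<open>
  A basis at \<open>p\<close> chosen among the \<open>v a p\<close> has \<open>r\<close> members, and these remain independent near \<open>p\<close>.
  The rank being \<open>r\<close> there too, they still span the whole family, so that a field orthogonal to
  them is orthogonal to every \<open>v a\<close>.
\<close>

lemma constant_rank_orthogonal_field:
  fixes v :: "'i \<Rightarrow> 'a::euclidean_space \<Rightarrow> 'a"
  assumes "finite A" "\<forall>a\<in>A. C1_field (v a)"
    and rank: "\<forall>\<^sub>F x in nhds p. dim ((\<lambda>a. v a x) ` A) = r"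
    and "\<forall>a\<in>A. v a p \<bullet> d = 0"
  obtains F where "C1_field F" "F p = d" "\<forall>\<^sub>F x in nhds p. \<forall>a\<in>A. v a x \<bullet> F x = 0"
proof -
  obtain C where C: "C \<subseteq> (\<lambda>a. v a p) ` A" "independent C" "card C = dim ((\<lambda>a. v a p) ` A)"
    by (rule basis_exists[of "(\<lambda>a. v a p) ` A"])
  then obtain B where B: "B \<subseteq> A" "inj_on (\<lambda>a. v a p) B" "C = (\<lambda>a. v a p) ` B"
    using subset_image_inj by metis
  have cardB: "card B = r"
    using C(3) eventually_nhds_x_imp_x[OF rank] card_image[OF B(2)] by (simp add: B(3))
  have "finite B"
    using B(1) assms(1) finite_subset by blast
  have smooth: "\<forall>b\<in>B. C1_field (v b)"
    using assms(2) B(1) by blast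
  note hyps = \<open>finite B\<close> smooth B(2) C(2)[unfolded B(3)]
  obtain F where F: "C1_field F" "F p = d" "\<forall>b\<in>B. \<forall>x. v b x \<bullet> F x = 0"
    using orthogonal_C1_field[OF hyps, of d] assms(4) B(1) by blast
  have "\<forall>\<^sub>F x in nhds p. inj_on (\<lambda>b. v b x) B \<and> independent ((\<lambda>b. v b x) ` B)"
    by (rule eventually_independent[OF hyps])
  then have "\<forall>\<^sub>F x in nhds p. \<forall>a\<in>A. v a x \<bullet> F x = 0"
    using rank
  proof eventually_elim
    case (elim x)
    have "(\<lambda>a. v a x) ` A \<subseteq> span ((\<lambda>b. v b x) ` B)"
      using elim cardB B(1)
      by (intro card_ge_dim_independent) (auto simp: card_image)
    moreover have "orthogonal (F x) w" if "w \<in> span ((\<lambda>b. v b x) ` B)" for w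
      using that by (rule orthogonal_to_span) (use F(3) in \<open>auto simp: orthogonal_def inner_commute\<close>)
    ultimately have "orthogonal (F x) (v a x)" if "a \<in> A" for a
      using that by blast
    then show ?case
      by (simp add: orthogonal_def inner_commute)
  qed
  with F that show ?thesis by blast
qed

section \<open>Local solvability of autonomous differential equations\<close>

text \<open>
  The Picard operator \<open>T x t = p + \<integral>\<^sub>0\<^sup>t F (x s) ds\<close> is a contraction for the supremum norm when the
  time interval is short against the Lipschitz constant.  Time is clamped to \<open>{0..\<delta>}\<close> so that \<open>T\<close>
  acts on the complete type of bounded continuous functions on all of \<open>real\<close>.
\<close>

lemma picard_global_lipschitz:
  fixes F :: "'a::euclidean_space \<Rightarrow> 'a"
  assumes lip: "L-lipschitz_on UNIV F"
  obtains \<delta> \<xi> where "\<delta> > 0" "\<xi> 0 = p"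
    "\<And>t. t \<in> {0..\<delta>} \<Longrightarrow> (\<xi> has_vector_derivative F (\<xi> t)) (at t within {0..\<delta>})"
proof -
  have L: "0 \<le> L" and FL: "\<And>x y. dist (F x) (F y) \<le> L * dist x y"
    using lip by (auto simp: lipschitz_on_def)
  \<comment> \<open>The summand 1 covers \<open>L = 0\<close>; the contraction factor is then \<open>\<delta> * L \<le> 1 / 2\<close>.\<close>
  define \<delta> where "\<delta> = 1 / (2 * (L + 1))"
  have \<delta>: "\<delta> > 0" "\<delta> * L \<le> 1 / 2"
    using L by (auto simp: \<delta>_def field_simps)
  define c where "c t = max 0 (min \<delta> t)" for t
  have c: "c t \<in> {0..\<delta>}" for t
    using \<delta> by (auto simp: c_def)
  define T where "T x t = p + integral {0..c t} (\<lambda>s. F (x s))" for x :: "real \<Rightarrow>\<^sub>C 'a" and t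
  have contF: "continuous_on S (\<lambda>s. F (apply_bcontfun x s))" for S :: "real set" and x
    by (rule continuous_on_compose2[OF lipschitz_on_continuous_on[OF lip]]) auto
  have int: "(\<lambda>s. F (apply_bcontfun x s)) integrable_on {0..b}" for x and b :: real
    by (rule integrable_continuous_real[OF contF])
  have "T x \<in> bcontfun" for x
  proof -
    have cont: "continuous_on {0..\<delta>} (\<lambda>u. p + integral {0..u} (\<lambda>s. F (x s)))"
      by (intro continuous_intros indefinite_integral_continuous_1 int)
    have "continuous_on UNIV (T x)"
      unfolding T_def[abs_def]
      by (rule continuous_on_compose2[OF cont])
         (use c in \<open>auto simp: c_def[abs_def] intro!: continuous_intros\<close>)
    moreover have "range (T x) \<subseteq> (\<lambda>u. p + integral {0..u} (\<lambda>s. F (x s))) ` {0..\<delta>}"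
      using c by (auto simp: T_def)
    then have "bounded (range (T x))"
      using compact_continuous_image[OF cont] compact_imp_bounded bounded_subset by blast
    ultimately show ?thesis
      by (simp add: bcontfun_def)
  qed
  then have apply_T: "apply_bcontfun (Bcontfun (T x)) = T x" for x
    by (simp add: Bcontfun_inverse)
  have contraction: "dist (Bcontfun (T x)) (Bcontfun (T y)) \<le> 1 / 2 * dist x y" for x y
  proof (rule dist_bound, unfold apply_T)
    fix t
    have "norm (integral {0..c t} (\<lambda>s. F (x s) - F (y s))) \<le> L * dist x y * (c t - 0)"
    proof (rule integral_bound)
      fix s
      have "dist (F (x s)) (F (y s)) \<le> L * dist (x s) (y s)"
        by (rule FL)
      also have "\<dots> \<le> L * dist x y"
        by (intro mult_left_mono dist_bounded L)
      finally show "norm (F (x s) - F (y s)) \<le> L * dist x y"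
        by (simp add: dist_norm)
    qed (use c[of t] contF in \<open>auto intro: continuous_on_diff\<close>)
    also have "\<dots> \<le> L * dist x y * \<delta>"
      using c[of t] L by (intro mult_left_mono) auto
    also have "\<dots> = (\<delta> * L) * dist x y"
      by simp
    also have "\<dots> \<le> 1 / 2 * dist x y"
      by (intro mult_right_mono \<delta>) simp
    finally show "dist (T x t) (T y t) \<le> 1 / 2 * dist x y"
      by (simp add: T_def dist_norm integral_diff[OF int int])
  qed
  have "\<exists>!x. Bcontfun (T x) = x"
    by (rule banach_fix_type[where c="1/2"]) (use contraction in auto)
  then obtain x where "Bcontfun (T x) = x"
    by blast
  then have x: "apply_bcontfun x t = T x t" for t
    using apply_T by metis
  show thesis
  proof
    show "\<delta> > 0" "apply_bcontfun x 0 = p"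
      using \<delta> x[of 0] by (auto simp: T_def c_def)
    fix t assume t: "t \<in> {0..\<delta>}"
    have *: "((\<lambda>u. p + integral {0..u} (\<lambda>s. F (x s))) has_vector_derivative F (x t)) (at t within {0..\<delta>})"
      using has_vector_derivative_add[OF has_vector_derivative_const integral_has_vector_derivative[OF contF t]]
      by simp
    show "(apply_bcontfun x has_vector_derivative F (x t)) (at t within {0..\<delta>})"
    proof (rule has_vector_derivative_transform[OF t _ *])
      fix u assume "u \<in> {0..\<delta>}"
      then show "apply_bcontfun x u = p + integral {0..u} (\<lambda>s. F (x s))"
        using x[of u] by (simp add: T_def c_def)
    qed
  qed
qed

text \<open>
  A \<open>C\<^sup>1\<close> field is Lipschitz only on balls.  Composed with the nearest point projection onto a ball
  around \<open>p\<close>, which does not increase distances, it becomes globally Lipschitz without changing on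
  the ball, and a solution of the modified equation stays in the ball for a short time.  The
  predicate \<open>Q\<close> carries any further property that holds near \<open>p\<close> along the curve.
\<close>

lemma C1_field_integral_curve:
  fixes F :: "'a::euclidean_space \<Rightarrow> 'a"
  assumes "C1_field F" "\<forall>\<^sub>F x in nhds p. Q x"
  obtains \<delta> \<xi> where "\<delta> > 0" "\<xi> 0 = p"
    "\<And>t. t \<in> {0..<\<delta>} \<Longrightarrow> (\<xi> has_vector_derivative F (\<xi> t)) (at t within {0..<\<delta>})"
    "\<And>t. t \<in> {0..<\<delta>} \<Longrightarrow> Q (\<xi> t)"
proof -
  obtain r L where r: "r > 0" and lip: "L-lipschitz_on (cball p r) F"
    using C1_field_locally_lipschitz[OF assms(1)] by blast
  let ?\<pi> = "closest_point (cball p r)"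
  have ne: "cball p r \<noteq> {}"
    using r by simp
  have "L-lipschitz_on UNIV (\<lambda>x. F (?\<pi> x))"
  proof (rule lipschitz_onI)
    show L: "0 \<le> L"
      using lip by (rule lipschitz_on_nonneg)
    fix x y
    have "dist (F (?\<pi> x)) (F (?\<pi> y)) \<le> L * dist (?\<pi> x) (?\<pi> y)"
      using ne by (intro lipschitz_onD[OF lip] closest_point_in_set) auto
    also have "\<dots> \<le> L * dist x y"
      using ne by (intro mult_left_mono L closest_point_lipschitz) auto
    finally show "dist (F (?\<pi> x)) (F (?\<pi> y)) \<le> L * dist x y" .
  qed
  then obtain \<delta> \<xi> where \<delta>: "\<delta> > 0" and \<xi>0: "\<xi> 0 = p"
    and \<xi>: "\<And>t. t \<in> {0..\<delta>} \<Longrightarrow> (\<xi> has_vector_derivative F (?\<pi> (\<xi> t))) (at t within {0..\<delta>})"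
    using picard_global_lipschitz by blast
  have "continuous (at 0 within {0..\<delta>}) \<xi>"
    using \<xi>[of 0] \<delta> has_vector_derivative_continuous by fastforce
  then have "(\<xi> \<longlongrightarrow> p) (at_right 0)"
    using \<delta> \<xi>0 by (simp add: continuous_within at_within_Icc_at_right)
  moreover have "\<forall>\<^sub>F x in nhds p. Q x \<and> x \<in> cball p r"
    using assms(2) r eventually_nhds_in_open[of "ball p r" p]
    by (auto elim: eventually_elim2)
  ultimately have "\<forall>\<^sub>F t in at_right 0. Q (\<xi> t) \<and> \<xi> t \<in> cball p r"
    by (rule eventually_compose_filterlim[rotated])
  then obtain b where b: "b > 0" "\<And>t. 0 < t \<Longrightarrow> t < b \<Longrightarrow> Q (\<xi> t) \<and> \<xi> t \<in> cball p r"
    by (auto simp: eventually_at_right_field)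
  define \<eta> where "\<eta> = min \<delta> b"
  have near: "Q (\<xi> t)" "\<xi> t \<in> cball p r" if "t \<in> {0..<\<eta>}" for t
    using that b \<xi>0 r eventually_nhds_x_imp_x[OF assms(2)]
    by (cases "t = 0"; force simp: \<eta>_def)+
  show thesis
  proof
    show "\<eta> > 0" "\<xi> 0 = p"
      using \<delta> b \<xi>0 by (auto simp: \<eta>_def)
    fix t assume t: "t \<in> {0..<\<eta>}"
    then have "(\<xi> has_vector_derivative F (?\<pi> (\<xi> t))) (at t within {0..<\<eta>})"
      using \<xi>[of t] by (auto simp: \<eta>_def intro: has_vector_derivative_within_subset)
    then show "(\<xi> has_vector_derivative F (\<xi> t)) (at t within {0..<\<eta>})"
      using near(2)[OF t] by (simp add: closest_point_self)
  qed (rule near)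
qed

section \<open>Arcs in the zero set of a system of constant rank\<close>

lemma gderiv_along_curve:
  fixes f :: "'a::real_inner \<Rightarrow> real" and \<xi> :: "real \<Rightarrow> 'a"
  assumes "GDERIV f (\<xi> t) :> D" "(\<xi> has_vector_derivative d) (at t within S)"
  shows "((\<lambda>s. f (\<xi> s)) has_real_derivative D \<bullet> d) (at t within S)"
proof -
  have "(f has_derivative (\<lambda>h. h \<bullet> D)) (at (\<xi> t))"
    using assms(1) by (simp add: gderiv_def)
  from diff_chain_within[OF assms(2)[unfolded has_vector_derivative_def] has_derivative_at_withinI[OF this]]
  show ?thesis
    by (simp add: has_field_derivative_def o_def inner_commute mult_commute_abs)
qed

text \<open>
  The arc is an integral curve of a \<open>C\<^sup>1\<close> field through \<open>d\<close> orthogonal to the gradients: every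
  \<open>f \<in> S\<close> has derivative zero along it, and differentiating \<open>\<xi>' = F \<circ> \<xi>\<close> gives the second
  derivative.
\<close>

lemma constant_rank_arc:
  fixes S :: "(real^'n \<Rightarrow> real) set"
  assumes "finite S" "\<forall>f\<in>S. twice_cont_diff f" "\<forall>f\<in>S. f p = 0"
    and rank: "\<forall>\<^sub>F x in nhds p. dim ((\<lambda>f. grad f x) ` S) = r"
    and "\<forall>f\<in>S. grad f p \<bullet> d = 0"
  obtains \<delta> \<xi> where "\<delta> > 0" "\<xi> 0 = p" "(\<xi> has_vector_derivative d) (at_right 0)"
    "twice_diff_arc_on \<xi> {0..<\<delta>}" "\<forall>t\<in>{0..<\<delta>}. \<forall>f\<in>S. f (\<xi> t) = 0"
proof -
  obtain F where F: "C1_field F" "F p = d" "\<forall>\<^sub>F x in nhds p. \<forall>f\<in>S. grad f x \<bullet> F x = 0"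
    using constant_rank_orthogonal_field[OF assms(1) _ rank assms(5)] assms(2) C1_field_grad
    by blast
  obtain \<delta> \<xi> where \<delta>: "\<delta> > 0" and \<xi>0: "\<xi> 0 = p"
    and \<xi>: "\<And>t. t \<in> {0..<\<delta>} \<Longrightarrow> (\<xi> has_vector_derivative F (\<xi> t)) (at t within {0..<\<delta>})"
    and tangent: "\<And>t. t \<in> {0..<\<delta>} \<Longrightarrow> \<forall>f\<in>S. grad f (\<xi> t) \<bullet> F (\<xi> t) = 0"
    using C1_field_integral_curve[OF F(1,3)] by blast
  obtain F' where F': "\<And>x. (F has_derivative blinfun_apply (F' x)) (at x)"
    using F(1) unfolding C1_field_def by blast
  have "((\<lambda>t. F (\<xi> t)) has_vector_derivative F' (\<xi> t) (F (\<xi> t))) (at t within {0..<\<delta>})"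
    if "t \<in> {0..<\<delta>}" for t
    using diff_chain_within[OF \<xi>[OF that, unfolded has_vector_derivative_def]
        has_derivative_at_withinI[OF F']]
    by (simp add: has_vector_derivative_def o_def blinfun.scaleR_right)
  then have twice: "twice_diff_arc_on \<xi> {0..<\<delta>}"
    unfolding twice_diff_arc_on_def using \<xi>
    by (intro exI ballI conjI)
  have right: "(\<xi> has_vector_derivative d) (at_right 0)"
  proof -
    have "(\<xi> has_vector_derivative d) (at 0 within {0..\<delta>/2})"
      using \<xi>[of 0] \<delta> F(2) \<xi>0 by (auto intro: has_vector_derivative_within_subset)
    then show ?thesis
      using \<delta> by (simp add: at_within_Icc_at_right)
  qed
  have "f (\<xi> t) = 0" if t: "t \<in> {0..<\<delta>}" and f: "f \<in> S" for t f
  proof -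
    have "((\<lambda>s. f (\<xi> s)) has_real_derivative 0) (at u within {0..<\<delta>})" if "u \<in> {0..<\<delta>}" for u
      using gderiv_along_curve[OF _ \<xi>[OF that], of f "grad f (\<xi> u)"] tangent[OF that] f assms(2)
      by (auto simp: twice_cont_diff_def)
    then have "\<exists>c. \<forall>s\<in>{0..<\<delta>}. f (\<xi> s) = c"
      by (intro has_field_derivative_zero_constant) auto
    then show ?thesis
      using t \<delta> \<xi>0 assms(3) f by (metis atLeastLessThan_iff order_refl)
  qed
  with \<delta> \<xi>0 twice right that show ?thesis by blast
qed

section \<open>The constraint qualification\<close>

lemma eventually_negative_along_curve:
  fixes f :: "'a::real_inner \<Rightarrow> real" and \<xi> :: "real \<Rightarrow> 'a"
  assumes "GDERIV f (\<xi> 0) :> D" "(\<xi> has_vector_derivative d) (at_right 0)"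
    and "f (\<xi> 0) < 0 \<or> f (\<xi> 0) = 0 \<and> D \<bullet> d < 0"
  shows "\<forall>\<^sub>F t in at_right 0. f (\<xi> t) < 0"
proof -
  note der = gderiv_along_curve[OF assms(1,2)]
  show ?thesis
    using assms(3)
  proof
    assume "f (\<xi> 0) < 0"
    moreover have "((\<lambda>t. f (\<xi> t)) \<longlongrightarrow> f (\<xi> 0)) (at_right 0)"
      using DERIV_continuous[OF der] by (simp add: continuous_within)
    ultimately show ?thesis
      by (rule order_tendstoD(2)[rotated])
  next
    assume "f (\<xi> 0) = 0 \<and> D \<bullet> d < 0"
    with has_real_derivative_neg_dec_right[OF der] show ?thesis
      by (auto simp: eventually_at_right_field)
  qed
qed

theorem lemma3p1:
  fixes P :: "('n::finite) mpsc" and xb :: "real^'n"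
  assumes "mpsc_smooth P"
    and "xb \<in> feasible_set P"
    and "MPSC_RCRCQ P xb"
  shows "MPSC_SSOCQ P xb"
  unfolding MPSC_SSOCQ_def
proof (intro ballI impI)
  fix d assume d: "d \<in> lin_cone P xb"
  define I where "I = {i\<in>I_g P xb. grad (ineq P i) xb \<bullet> d = 0}"
  define J where "J = {k\<in>I_GH P xb. grad (swG P k) xb \<bullet> d = 0}"
  define K where "K = {k\<in>I_GH P xb. grad (swH P k) xb \<bullet> d = 0}"
  define S where "S = ineq P ` I \<union> eqn P ` I_h P \<union> swG P ` (J \<union> I_G P xb) \<union> swH P ` (K \<union> I_H P xb)"
  note index_defs = I_def J_def K_def I_g_def I_h_def I_G_def I_H_def I_GH_def
  have smooth: "\<forall>f\<in>S. twice_cont_diff f"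
    using assms(1) by (auto simp: S_def index_defs mpsc_smooth_def)
  have "finite S"
    by (simp add: S_def index_defs)
  have zero: "\<forall>f\<in>S. f xb = 0"
    using assms(2) by (auto simp: S_def index_defs feasible_set_def)
  have orth: "\<forall>f\<in>S. grad f xb \<bullet> d = 0"
    using d by (auto simp: S_def I_def J_def K_def lin_cone_def)
  have family: "grad_family P I (I_h P) (J \<union> I_G P xb) (K \<union> I_H P xb) x = (\<lambda>f. grad f x) ` S" for x
    by (simp add: grad_family_def S_def image_Un image_image)
  obtain \<epsilon> r where "\<epsilon> > 0" "\<And>x. norm (x - xb) < \<epsilon> \<Longrightarrow> dim ((\<lambda>f. grad f x) ` S) = r"
  proof -
    have "I \<subseteq> I_g P xb" "J \<subseteq> I_GH P xb" "K \<subseteq> I_GH P xb"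
      by (auto simp: I_def J_def K_def)
    with assms(3) that show thesis
      unfolding MPSC_RCRCQ_def family[symmetric] by blast
  qed
  then have rank: "\<forall>\<^sub>F x in nhds xb. dim ((\<lambda>f. grad f x) ` S) = r"
    unfolding eventually_nhds_metric dist_norm by blast
  obtain \<delta> \<xi> where \<delta>: "\<delta> > 0" and \<xi>0: "\<xi> 0 = xb" and right: "(\<xi> has_vector_derivative d) (at_right 0)"
    and twice: "twice_diff_arc_on \<xi> {0..<\<delta>}" and on_S: "\<forall>t\<in>{0..<\<delta>}. \<forall>f\<in>S. f (\<xi> t) = 0"
    using constant_rank_arc[OF \<open>finite S\<close> smooth zero rank orth] by blast
  have "\<forall>\<^sub>F t in at_right 0. ineq P i (\<xi> t) < 0" if i: "i \<in> {1..num_ineq P} - I" for i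
  proof (rule eventually_negative_along_curve[OF _ right])
    show "GDERIV (ineq P i) (\<xi> 0) :> grad (ineq P i) xb"
      using assms(1) i \<xi>0 by (auto simp: mpsc_smooth_def twice_cont_diff_def)
    have "i \<in> I_g P xb \<or> ineq P i xb < 0"
      using assms(2) i by (auto simp: I_g_def feasible_set_def less_le)
    moreover have "i \<in> I_g P xb \<Longrightarrow> ineq P i xb = 0 \<and> grad (ineq P i) xb \<bullet> d < 0"
      using d i by (auto simp: I_def lin_cone_def I_g_def less_le)
    ultimately show "ineq P i (\<xi> 0) < 0 \<or> ineq P i (\<xi> 0) = 0 \<and> grad (ineq P i) xb \<bullet> d < 0"
      using \<xi>0 by auto
  qed
  then have "\<forall>\<^sub>F t in at_right 0. \<forall>i\<in>{1..num_ineq P} - I. ineq P i (\<xi> t) < 0"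
    by (simp add: eventually_ball_finite)
  then obtain b where b: "b > 0" "\<And>t i. 0 < t \<Longrightarrow> t < b \<Longrightarrow> i \<in> {1..num_ineq P} - I \<Longrightarrow> ineq P i (\<xi> t) < 0"
    by (auto simp: eventually_at_right_field)
  define \<eta> where "\<eta> = min \<delta> b"
  have \<eta>: "\<eta> > 0" "{0..<\<eta>} \<subseteq> {0..<\<delta>}"
    using \<delta> b(1) by (auto simp: \<eta>_def)
  have zeros: "\<forall>t\<in>{0..<\<eta>}. (\<forall>i\<in>I. ineq P i (\<xi> t) = 0) \<and> (\<forall>j\<in>I_h P. eqn P j (\<xi> t) = 0) \<and>
      (\<forall>k\<in>I_G P xb \<union> J. swG P k (\<xi> t) = 0) \<and> (\<forall>k\<in>I_H P xb \<union> K. swH P k (\<xi> t) = 0)"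
    using on_S \<eta>(2) by (auto simp: S_def)
  \<comment> \<open>For a biactive index, the product of the directional derivatives along \<open>d\<close> vanishes, hence one
    of its factors does.\<close>
  have "J \<union> K = I_GH P xb"
    using d by (auto simp: J_def K_def lin_cone_def)
  then have cover: "{1..num_sw P} \<subseteq> (I_G P xb \<union> J) \<union> (I_H P xb \<union> K)"
    using assms(2) by (auto simp: feasible_set_def I_G_def I_H_def I_GH_def)
  have feasible: "\<forall>t\<in>{0..<\<eta>}. \<xi> t \<in> feasible_set P"
  proof
    fix t assume t: "t \<in> {0..<\<eta>}"
    show "\<xi> t \<in> feasible_set P"
    proof (cases "t = 0")
      case True
      then show ?thesis
        using assms(2) \<xi>0 by simp
    next
      case False
      have "ineq P i (\<xi> t) \<le> 0" if "i \<in> {1..num_ineq P}" for i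
        using zeros t that False b(2)[of t i] by (cases "i \<in> I") (auto simp: \<eta>_def less_imp_le)
      moreover have "swG P k (\<xi> t) * swH P k (\<xi> t) = 0" if "k \<in> {1..num_sw P}" for k
      proof -
        have "k \<in> I_G P xb \<union> J \<or> k \<in> I_H P xb \<union> K"
          using cover that by blast
        then have "swG P k (\<xi> t) = 0 \<or> swH P k (\<xi> t) = 0"
          using zeros t by blast
        then show ?thesis
          by simp
      qed
      ultimately show ?thesis
        using zeros t by (auto simp: feasible_set_def I_h_def)
    qed
  qed
  have twice': "twice_diff_arc_on \<xi> {0..<\<eta>}"
    using twice \<eta>(2) unfolding twice_diff_arc_on_def
    by (meson has_vector_derivative_within_subset subsetD)
  have subsets: "J \<subseteq> I_GH P xb" "K \<subseteq> I_GH P xb"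
    by (auto simp: J_def K_def)
  have active: "\<forall>t\<in>{0..<\<eta>}. (\<forall>i\<in>{i\<in>I_g P xb. grad (ineq P i) xb \<bullet> d = 0}. ineq P i (\<xi> t) = 0) \<and>
      (\<forall>k\<in>I_G P xb \<union> J. swG P k (\<xi> t) = 0) \<and> (\<forall>k\<in>I_H P xb \<union> K. swH P k (\<xi> t) = 0)"
    using zeros unfolding I_def by blast
  show "\<exists>\<delta>>0. \<exists>J K. \<exists>\<xi> :: real \<Rightarrow> real^'n.
      J \<subseteq> I_GH P xb \<and> K \<subseteq> I_GH P xb \<and> twice_diff_arc_on \<xi> {0..<\<delta>} \<and>
      (\<forall>t\<in>{0..<\<delta>}. \<xi> t \<in> feasible_set P) \<and>
      \<xi> 0 = xb \<and> (\<xi> has_vector_derivative d) (at_right 0) \<and>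
      (\<forall>t\<in>{0..<\<delta>}.
         (\<forall>i\<in>{i\<in>I_g P xb. grad (ineq P i) xb \<bullet> d = 0}. ineq P i (\<xi> t) = 0) \<and>
         (\<forall>k\<in>I_G P xb \<union> J. swG P k (\<xi> t) = 0) \<and>
         (\<forall>k\<in>I_H P xb \<union> K. swH P k (\<xi> t) = 0))"
    by (rule exI[of _ \<eta>], rule conjI[OF \<eta>(1)], rule exI[of _ J], rule exI[of _ K], rule exI[of _ \<xi>])
       (intro conjI subsets twice' feasible \<xi>0 right active)
qed

end
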